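(* Let $N\geq 3$ and let $a_1,\dots,a_N\in\mathbb{C}$ with $\sum_{i=1}^N|a_i|^2=1$. Let $|W\rangle_{A_1A_2\cdots A_N}=a_1|10\cdots0\rangle+a_2|01\cdots0\rangle+\cdots+a_N|00\cdots1\rangle\in(\mathbb{C}^2)^{\otimes N}$ be the corresponding $N$-qubit $W$-class state. Then $$\mathcal{C}_N^2(|W\rangle_{A_1A_2\cdots A_N})=\frac{1}{\binom N2-1}\,\widetilde{\mathcal{C}}_{N-1}^2(|W\rangle_{A_1A_2\cdots A_N}).$$
   Context: $\{|0\rangle,|1\rangle\}$ is the standard orthonormal basis of $\mathbb{C}^2$; the coefficient $a_i$ multiplies the product basis vector with $|1\rangle$ in the $i$-th tensor factor and $|0\rangle$ in all the others. $M$-partite concurrence with respect to a partition: let $|\psi\rangle\in H_1\otimes\cdots\otimes H_N$ be a unit vector and let $\mathcal{P}$ be a partition of $\{1,\dots,N\}$ into $M$ non-empty blocks. Each block is regarded as a single party, and, writing $\rho=|\psi\rangle\langle\psi|$, $$\mathcal{C}_M(\rho_{\mathcal{P}})=2^{1-\frac M2}\sqrt{(2^M-2)-\sum_\alpha \mathrm{Tr}(\rho_\alpha^2)},$$ where $\alpha$ runs over all $2^M-2$ non-empty proper subsets of the set of blocks of $\mathcal{P}$, and $\rho_\alpha$ is the reduced density matrix of $\rho$ on the union of the blocks in $\alpha$ (partial trace over all other subsystems). The $N$-partite concurrence $\mathcal{C}_N(|\psi\rangle)$ is the case $M=N$, where all blocks are singletons. $\widetilde{\mathcal{C}}_{N-1}^2(|\psi\rangle)=\sum_{\mathcal{P}}\mathcal{C}_{N-1}^2(\rho_{\mathcal{P}})$,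 where $\mathcal{P}$ runs over all $\binom N2$ partitions of $\{1,\dots,N\}$ into $N-1$ blocks, i.e. for each pair $1\le i<j\le N$ the partition with block $\{i,j\}$ and all other blocks singletons. *)

theory Defs
  imports "HOL-Analysis.Analysis" "HOL-Library.Disjoint_Sets"
begin

(* Subsystem i has the Hilbert space C^(d i) with standard basis indexed by {..<d i}.  The tensor
   product of the subsystems in S has its basis indexed by multi_idx d S: vectors are functions on
   these multi-indices, operators are functions of a (row, column) pair of them.  Values outside
   multi_idx d S are never looked at. *)

definition multi_idx :: "('i \<Rightarrow> nat) \<Rightarrow> 'i set \<Rightarrow> ('i \<Rightarrow> nat) set" where
  "multi_idx d S = (\<Pi>\<^sub>E i\<in>S. {..<d i})"

definition tensor_vec :: "'i set \<Rightarrow> ('i \<Rightarrow> nat \<Rightarrow> complex) \<Rightarrow> ('i \<Rightarrow> nat) \<Rightarrow> complex" where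
  "tensor_vec A v x = (\<Prod>i\<in>A. v i (x i))"

definition ket :: "nat \<Rightarrow> nat \<Rightarrow> complex" where
  "ket k l = (if l = k then 1 else 0)"

definition density_op :: "('x \<Rightarrow> complex) \<Rightarrow> 'x \<Rightarrow> 'x \<Rightarrow> complex" where
  "density_op \<psi> x y = \<psi> x * cnj (\<psi> y)"

definition op_mult :: "'x set \<Rightarrow> ('x \<Rightarrow> 'x \<Rightarrow> complex) \<Rightarrow> ('x \<Rightarrow> 'x \<Rightarrow> complex) \<Rightarrow> 'x \<Rightarrow> 'x \<Rightarrow> complex" where
  "op_mult B \<rho> \<sigma> x y = (\<Sum>z\<in>B. \<rho> x z * \<sigma> z y)"

definition op_trace :: "'x set \<Rightarrow> ('x \<Rightarrow> 'x \<Rightarrow> complex) \<Rightarrow> complex" where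
  "op_trace B \<rho> = (\<Sum>x\<in>B. \<rho> x x)"

(* Operator on the subsystems S obtained from one on A by tracing out A - S. *)
definition partial_trace ::
  "('i \<Rightarrow> nat) \<Rightarrow> 'i set \<Rightarrow> 'i set \<Rightarrow> (('i \<Rightarrow> nat) \<Rightarrow> ('i \<Rightarrow> nat) \<Rightarrow> complex)
     \<Rightarrow> ('i \<Rightarrow> nat) \<Rightarrow> ('i \<Rightarrow> nat) \<Rightarrow> complex" where
  "partial_trace d A S \<rho> x y =
     (\<Sum>z\<in>multi_idx d (A - S). \<rho> (merge S (A - S) (x, z)) (merge S (A - S) (y, z)))"

definition reduced_purity ::
  "('i \<Rightarrow> nat) \<Rightarrow> 'i set \<Rightarrow> (('i \<Rightarrow> nat) \<Rightarrow> complex) \<Rightarrow> 'i set \<Rightarrow> complex" where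
  "reduced_purity d A \<psi> S =
     (let \<rho>S = partial_trace d A S (density_op \<psi>); B = multi_idx d S
      in op_trace B (op_mult B \<rho>S \<rho>S))"

lemma reduced_purity_real: "reduced_purity d A \<psi> S \<in> \<real>"
proof -
  define \<rho> where "\<rho> = partial_trace d A S (density_op \<psi>)"
  have herm: "\<rho> y x = cnj (\<rho> x y)" for x y
    by (simp add: \<rho>_def partial_trace_def density_op_def mult.commute)
  have "\<rho> x y * \<rho> y x \<in> \<real>" for x y
    unfolding herm[of y x] complex_norm_square[symmetric] by simp
  then show ?thesis
    unfolding reduced_purity_def Let_def op_trace_def op_mult_def \<rho>_def[symmetric]
    by (intro sum_in_Reals)
qed

(* Concurrence of the pure state psi on the subsystems A with respect to a partition P of A; here
   M = card P and \<alpha> is a set of blocks.  Re only converts the (real) purities from type complex. *)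
definition concurrence ::
  "('i \<Rightarrow> nat) \<Rightarrow> 'i set \<Rightarrow> (('i \<Rightarrow> nat) \<Rightarrow> complex) \<Rightarrow> 'i set set \<Rightarrow> real" where
  "concurrence d A \<psi> P =
     2 powr (1 - real (card P) / 2) *
     sqrt ((2 ^ card P - 2) - (\<Sum>\<alpha>\<in>Pow P - {{}, P}. Re (reduced_purity d A \<psi> (\<Union>\<alpha>))))"

definition full_concurrence ::
  "('i \<Rightarrow> nat) \<Rightarrow> 'i set \<Rightarrow> (('i \<Rightarrow> nat) \<Rightarrow> complex) \<Rightarrow> real" where
  "full_concurrence d A \<psi> = concurrence d A \<psi> ((\<lambda>i. {i}) ` A)"

definition total_sq_concurrence ::
  "('i \<Rightarrow> nat) \<Rightarrow> 'i set \<Rightarrow> nat \<Rightarrow> (('i \<Rightarrow> nat) \<Rightarrow> complex) \<Rightarrow> real" where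
  "total_sq_concurrence d A M \<psi> =
     (\<Sum>P\<in>{P. partition_on A P \<and> card P = M}. (concurrence d A \<psi> P)\<^sup>2)"

definition W_state :: "nat \<Rightarrow> (nat \<Rightarrow> complex) \<Rightarrow> (nat \<Rightarrow> nat) \<Rightarrow> complex" where
  "W_state N a x =
     (\<Sum>i=1..N. a i * tensor_vec {1..N} (\<lambda>j. if j = i then ket 1 else ket 0) x)"

end

theory Submission
  imports Defs
begin

text \<open>
  Put \<open>p i = |a i|\<^sup>2\<close> and write \<open>p S\<close> for the total weight of \<open>S\<close>. The reduced state of the
  W-class state on \<open>S\<close> is the (unnormalised) W-class state on \<open>S\<close> plus \<open>1 - p S\<close> times the vacuum
  projector, and these two are orthogonal, so its purity is \<open>(p S)\<^sup>2 + (1 - p S)\<^sup>2\<close>. Summing over sets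
  of blocks, the squared concurrence with respect to a partition \<open>P\<close> becomes
  \<open>2 (1 - (\<Sum>b\<in>P. (p b)\<^sup>2))\<close>. Merging \<open>i\<close> and \<open>j\<close> lowers this by \<open>4 p i p j\<close>, and the sum of these
  losses over all pairs is \<open>2 (1 - (\<Sum>i. (p i)\<^sup>2))\<close>, one copy of the full squared concurrence.
\<close>

section \<open>Product basis vectors and single-excitation states\<close>

lemma tensor_vec_inner:
  assumes "finite S"
  shows "(\<Sum>x\<in>multi_idx d S. tensor_vec S v x * cnj (tensor_vec S w x))
       = (\<Prod>i\<in>S. \<Sum>k<d i. v i k * cnj (w i k))"
proof -
  have "(\<Prod>i\<in>S. \<Sum>k<d i. v i k * cnj (w i k))
      = (\<Sum>x\<in>multi_idx d S. \<Prod>i\<in>S. v i (x i) * cnj (w i (x i)))"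
    unfolding multi_idx_def using assms by (intro prod_sum_PiE) auto
  then show ?thesis
    by (simp add: tensor_vec_def prod.distrib)
qed

text \<open>This is the standard basis vector with a 1 exactly at the sites of \<open>T\<close>.
  Labelling by sets makes \<open>T = {}\<close> the vacuum and \<open>T = {i}\<close> the i-th term
  of the W-class state, and turns restriction to subsystems into set operations.\<close>

definition excitation_vec :: "'i set \<Rightarrow> 'i set \<Rightarrow> ('i \<Rightarrow> nat) \<Rightarrow> complex" where
  "excitation_vec S T = tensor_vec S (\<lambda>j. if j \<in> T then ket 1 else ket 0)"

lemma excitation_vec_inner:
  assumes "finite S" "T \<subseteq> S" "U \<subseteq> S"
  shows "(\<Sum>x\<in>multi_idx (\<lambda>_. 2) S. excitation_vec S T x * cnj (excitation_vec S U x))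
       = of_bool (T = U)"
proof -
  have "(\<Sum>k<(2::nat). (if j \<in> T then ket 1 else ket 0) k * cnj ((if j \<in> U then ket 1 else ket 0) k))
      = of_bool (j \<in> T \<longleftrightarrow> j \<in> U)" for j
    by (simp add: ket_def eval_nat_numeral)
  then have "(\<Sum>x\<in>multi_idx (\<lambda>_. 2) S. excitation_vec S T x * cnj (excitation_vec S U x))
      = (\<Prod>j\<in>S. of_bool (j \<in> T \<longleftrightarrow> j \<in> U))"
    unfolding excitation_vec_def using assms(1) by (simp only: tensor_vec_inner)
  also have "\<dots> = of_bool (T = U)"
    using assms by (cases "T = U") (auto simp: prod_zero_iff)
  finally show ?thesis .
qed

lemma excitation_vec_merge:
  assumes "finite A" "S \<subseteq> A"
  shows "excitation_vec A T (merge S (A - S) (x, z))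
       = excitation_vec S (T \<inter> S) x * excitation_vec (A - S) (T - S) z"
proof -
  have A: "A = S \<union> (A - S)" using assms by auto
  have "excitation_vec A T (merge S (A - S) (x, z)) =
      (\<Prod>i\<in>S. (if i \<in> T then ket 1 else ket 0) (merge S (A - S) (x, z) i)) *
      (\<Prod>i\<in>A - S. (if i \<in> T then ket 1 else ket 0) (merge S (A - S) (x, z) i))"
    unfolding excitation_vec_def tensor_vec_def
    using assms by (subst A, intro prod.union_disjoint) (auto intro: finite_subset)
  also have "\<dots> = excitation_vec S (T \<inter> S) x * excitation_vec (A - S) (T - S) z"
    unfolding excitation_vec_def tensor_vec_def
    by (intro arg_cong2[where f = "(*)"] prod.cong) (auto simp: merge_def)
  finally show ?thesis .
qed

text \<open>The W-class vector on an arbitrary set of qubits, deliberately left unnormalised so that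
  it also describes the pieces of a state on \<open>S\<close> and on \<open>A - S\<close>.\<close>

definition single_excitation :: "('i \<Rightarrow> complex) \<Rightarrow> 'i set \<Rightarrow> ('i \<Rightarrow> nat) \<Rightarrow> complex" where
  "single_excitation a S x = (\<Sum>i\<in>S. a i * excitation_vec S {i} x)"

lemma W_state_eq_single_excitation: "W_state N a = single_excitation a {1..N}"
  by (simp add: fun_eq_iff W_state_def single_excitation_def excitation_vec_def)

text \<open>The one excitation lies either in \<open>S\<close> or in \<open>A - S\<close>, and the
  other part is then in the vacuum.\<close>

lemma single_excitation_merge:
  assumes "finite A" "S \<subseteq> A"
  shows "single_excitation a A (merge S (A - S) (x, z))
       = single_excitation a S x * excitation_vec (A - S) {} z
       + excitation_vec S {} x * single_excitation a (A - S) z"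
proof -
  let ?f = "\<lambda>i. a i * (excitation_vec S ({i} \<inter> S) x * excitation_vec (A - S) ({i} - S) z)"
  have "single_excitation a A (merge S (A - S) (x, z)) = sum ?f A"
    using assms by (simp add: single_excitation_def excitation_vec_merge)
  also have "\<dots> = sum ?f (A - S) + sum ?f S"
    using assms by (rule sum.subset_diff[rotated])
  \<comment> \<open>For \<open>i\<close> in \<open>S\<close> the label \<open>{i} - S\<close> is
    empty; outside \<open>S\<close> it is \<open>{i} \<inter> S\<close> that is empty.\<close>
  also have "sum ?f S = (\<Sum>i\<in>S. a i * excitation_vec S {i} x * excitation_vec (A - S) {} z)"
    by (intro sum.cong) auto
  also have "sum ?f (A - S)
      = (\<Sum>i\<in>A - S. excitation_vec S {} x * (a i * excitation_vec (A - S) {i} z))"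
    by (intro sum.cong) (auto simp: insert_Diff_if)
  finally show ?thesis
    by (simp add: single_excitation_def sum_distrib_left sum_distrib_right)
qed

lemma vacuum_inner_vacuum:
  "finite S \<Longrightarrow> (\<Sum>x\<in>multi_idx (\<lambda>_. 2) S. excitation_vec S {} x * cnj (excitation_vec S {} x)) = 1"
  by (simp add: excitation_vec_inner)

lemma single_excitation_inner_vacuum:
  assumes "finite S"
  shows "(\<Sum>x\<in>multi_idx (\<lambda>_. 2) S. single_excitation a S x * cnj (excitation_vec S {} x)) = 0"
proof -
  have "(\<Sum>x\<in>multi_idx (\<lambda>_. 2) S. single_excitation a S x * cnj (excitation_vec S {} x))
      = (\<Sum>i\<in>S. a i * (\<Sum>x\<in>multi_idx (\<lambda>_. 2) S.
           excitation_vec S {i} x * cnj (excitation_vec S {} x)))"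
    unfolding single_excitation_def sum_distrib_right sum_distrib_left
    by (subst sum.swap) (simp add: mult.assoc)
  also have "\<dots> = 0"
    using assms by (intro sum.neutral) (simp add: excitation_vec_inner)
  finally show ?thesis .
qed

lemma vacuum_inner_single_excitation:
  assumes "finite S"
  shows "(\<Sum>x\<in>multi_idx (\<lambda>_. 2) S. excitation_vec S {} x * cnj (single_excitation a S x)) = 0"
  using arg_cong[OF single_excitation_inner_vacuum[OF assms, of a], of cnj]
  by (simp add: mult.commute)

text \<open>The vectors with labels \<open>{i}\<close> are orthonormal, so only the diagonal terms
  of the double sum survive.\<close>

lemma single_excitation_inner_single_excitation:
  assumes "finite S"
  shows "(\<Sum>x\<in>multi_idx (\<lambda>_. 2) S. single_excitation a S x * cnj (single_excitation a S x))
       = of_real (\<Sum>i\<in>S. (cmod (a i))\<^sup>2)"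
proof -
  let ?M = "multi_idx (\<lambda>_. 2) S"
  have "(\<Sum>x\<in>?M. single_excitation a S x * cnj (single_excitation a S x))
      = (\<Sum>x\<in>?M. \<Sum>i\<in>S. \<Sum>j\<in>S.
           a i * cnj (a j) * (excitation_vec S {i} x * cnj (excitation_vec S {j} x)))"
    by (simp add: single_excitation_def sum_product mult_ac)
  also have "\<dots> = (\<Sum>i\<in>S. \<Sum>j\<in>S. \<Sum>x\<in>?M.
           a i * cnj (a j) * (excitation_vec S {i} x * cnj (excitation_vec S {j} x)))"
    by (subst sum.swap, intro sum.cong refl, subst sum.swap, rule refl)
  also have "\<dots> = (\<Sum>i\<in>S. \<Sum>j\<in>S. a i * cnj (a j) * of_bool (i = j))"
    using assms by (intro sum.cong refl) (simp add: excitation_vec_inner flip: sum_distrib_left)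
  also have "\<dots> = (\<Sum>i\<in>S. a i * cnj (a i))"
    using assms by (intro sum.cong refl) (simp add: of_bool_def if_distrib cong: if_cong)
  finally show ?thesis
    by (simp add: complex_norm_square flip: of_real_power)
qed

section \<open>Reduced states and their purity\<close>

lemma partial_trace_single_excitation:
  assumes "finite A" "S \<subseteq> A"
  shows "partial_trace (\<lambda>_. 2) A S (density_op (single_excitation a A)) x y
       = single_excitation a S x * cnj (single_excitation a S y)
       + of_real (\<Sum>i\<in>A - S. (cmod (a i))\<^sup>2) * (excitation_vec S {} x * cnj (excitation_vec S {} y))"
proof -
  let ?Z = "multi_idx (\<lambda>_. 2) (A - S)" and ?u = "single_excitation a S" and ?o = "excitation_vec S {}"
    and ?v = "single_excitation a (A - S)" and ?p = "excitation_vec (A - S) {}"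
  have fin: "finite (A - S)" using assms by simp
  \<comment> \<open>The terms are grouped by what happens on the traced-out part. The two mixed ones
    vanish because vacuum and single excitation are orthogonal there.\<close>
  have "partial_trace (\<lambda>_. 2) A S (density_op (single_excitation a A)) x y
      = ?u x * cnj (?u y) * (\<Sum>z\<in>?Z. ?p z * cnj (?p z))
      + ?u x * cnj (?o y) * (\<Sum>z\<in>?Z. ?p z * cnj (?v z))
      + ?o x * cnj (?u y) * (\<Sum>z\<in>?Z. ?v z * cnj (?p z))
      + ?o x * cnj (?o y) * (\<Sum>z\<in>?Z. ?v z * cnj (?v z))"
    unfolding partial_trace_def density_op_def single_excitation_merge[OF assms]
      sum_distrib_left sum.distrib[symmetric]
    by (intro sum.cong refl) (simp add: algebra_simps)
  then show ?thesis
    by (simp only: vacuum_inner_vacuum[OF fin] vacuum_inner_single_excitation[OF fin]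
        single_excitation_inner_vacuum[OF fin] single_excitation_inner_single_excitation[OF fin])
      (simp add: mult_ac)
qed

lemma reduced_purity_single_excitation:
  assumes "finite A" "S \<subseteq> A"
  shows "reduced_purity (\<lambda>_. 2) A (single_excitation a A) S
       = of_real ((\<Sum>i\<in>S. (cmod (a i))\<^sup>2)\<^sup>2 + (\<Sum>i\<in>A - S. (cmod (a i))\<^sup>2)\<^sup>2)"
proof -
  have fin: "finite S" using assms by (rule finite_subset[rotated])
  let ?B = "multi_idx (\<lambda>_. 2) S" and ?u = "single_excitation a S" and ?o = "excitation_vec S {}"
  define q where "q = complex_of_real (\<Sum>i\<in>A - S. (cmod (a i))\<^sup>2)"
  have "reduced_purity (\<lambda>_. 2) A (single_excitation a A) S
      = (\<Sum>x\<in>?B. \<Sum>y\<in>?B. (?u x * cnj (?u y) + q * (?o x * cnj (?o y)))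
                      * (?u y * cnj (?u x) + q * (?o y * cnj (?o x))))"
    unfolding reduced_purity_def Let_def op_trace_def op_mult_def
      partial_trace_single_excitation[OF assms] q_def ..
  \<comment> \<open>The double sum factors into inner products of \<open>?u\<close> and
    \<open>?o\<close>; the two middle terms vanish by orthogonality on \<open>S\<close>.\<close>
  also have "\<dots> = (\<Sum>x\<in>?B. ?u x * cnj (?u x)) * (\<Sum>y\<in>?B. ?u y * cnj (?u y))
      + q * ((\<Sum>x\<in>?B. ?u x * cnj (?o x)) * (\<Sum>y\<in>?B. ?o y * cnj (?u y)))
      + q * ((\<Sum>x\<in>?B. ?o x * cnj (?u x)) * (\<Sum>y\<in>?B. ?u y * cnj (?o y)))
      + q\<^sup>2 * ((\<Sum>x\<in>?B. ?o x * cnj (?o x)) * (\<Sum>y\<in>?B. ?o y * cnj (?o y)))"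
    unfolding sum_product unfolding sum_distrib_left sum.distrib[symmetric]
    by (intro sum.cong refl) (simp add: algebra_simps power2_eq_square)
  finally show ?thesis
    by (simp only: vacuum_inner_vacuum[OF fin] vacuum_inner_single_excitation[OF fin]
        single_excitation_inner_vacuum[OF fin] single_excitation_inner_single_excitation[OF fin])
      (simp add: q_def power2_eq_square)
qed

section \<open>Sums over sets of blocks and the concurrence of a partition\<close>

lemma sum_Pow_insert:
  assumes "finite P" "b \<notin> P"
  shows "sum f (Pow (insert b P)) = (\<Sum>\<alpha>\<in>Pow P. f \<alpha> + f (insert b \<alpha>))"
proof -
  have "sum f (Pow (insert b P)) = sum f (Pow P) + sum f (insert b ` Pow P)"
    unfolding Pow_insert using assms by (intro sum.union_disjoint) auto
  also have "sum f (insert b ` Pow P) = (\<Sum>\<alpha>\<in>Pow P. f (insert b \<alpha>))"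
    using assms(2) by (subst sum.reindex) (auto simp: inj_on_def)
  finally show ?thesis by (simp add: sum.distrib)
qed

text \<open>An ordered pair of distinct elements b, c has b in \<open>\<alpha>\<close> and c outside
  it for a quarter of all subsets \<open>\<alpha>\<close>, and the products \<open>w b * w c\<close>
  over such pairs add up to the bracket on the right. The factor 4 on the left avoids the exponent
  \<open>card P - 2\<close>.\<close>

lemma sum_Pow_cut_weight:
  fixes w :: "'b \<Rightarrow> real"
  assumes "finite P"
  shows "4 * (\<Sum>\<alpha>\<in>Pow P. sum w \<alpha> * sum w (P - \<alpha>))
       = 2 ^ card P * ((sum w P)\<^sup>2 - (\<Sum>b\<in>P. (w b)\<^sup>2))"
  using assms
proof (induction P)
  case empty
  then show ?case by simp
next
  case (insert b P)
  \<comment> \<open>The new element joins either side of the cut and each time contributes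
    \<open>w b\<close> times the weight of the opposite side; together this gives
    \<open>w b * sum w P\<close>.\<close>
  have "(\<Sum>\<alpha>\<in>Pow (insert b P). sum w \<alpha> * sum w (insert b P - \<alpha>))
      = (\<Sum>\<alpha>\<in>Pow P. 2 * (sum w \<alpha> * sum w (P - \<alpha>)) + w b * sum w P)"
    unfolding sum_Pow_insert[OF insert.hyps]
  proof (intro sum.cong refl)
    fix \<alpha> assume "\<alpha> \<in> Pow P"
    then have \<alpha>: "\<alpha> \<subseteq> P" "finite \<alpha>" "b \<notin> \<alpha>"
      using insert.hyps by (auto intro: finite_subset)
    have eqs: "insert b P - \<alpha> = insert b (P - \<alpha>)" "insert b P - insert b \<alpha> = P - \<alpha>"
      using \<alpha> insert.hyps by auto
    have P: "sum w P = sum w (P - \<alpha>) + sum w \<alpha>"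
      using \<alpha>(1) insert.hyps(1) by (rule sum.subset_diff)
    show "sum w \<alpha> * sum w (insert b P - \<alpha>) + sum w (insert b \<alpha>) * sum w (insert b P - insert b \<alpha>)
        = 2 * (sum w \<alpha> * sum w (P - \<alpha>)) + w b * sum w P"
      unfolding eqs P using \<alpha> insert.hyps by (simp add: algebra_simps)
  qed
  also have "\<dots> = 2 * (\<Sum>\<alpha>\<in>Pow P. sum w \<alpha> * sum w (P - \<alpha>)) + 2 ^ card P * (w b * sum w P)"
    using insert.hyps by (simp add: sum.distrib card_Pow flip: sum_distrib_left)
  finally show ?case
    using insert by (simp add: algebra_simps power2_eq_square)
qed

text \<open>If \<open>\<alpha>\<close> carries weight t, its purity is 1 - 2t(1 - t). The ones
  cancel \<open>2 ^ card P - 2\<close>, and the squared prefactor \<open>4 / 2 ^ card P\<close>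
  cancels the power of 2 in the cut sum. Arbitrary partitions are allowed so that singletons and
  merged pairs are covered at once.\<close>

lemma concurrence_single_excitation:
  assumes "finite A" "partition_on A P" "A \<noteq> {}" and norm: "(\<Sum>i\<in>A. (cmod (a i))\<^sup>2) = 1"
  shows "(concurrence (\<lambda>_. 2) A (single_excitation a A) P)\<^sup>2
       = 2 * (1 - (\<Sum>b\<in>P. (\<Sum>i\<in>b. (cmod (a i))\<^sup>2)\<^sup>2))"
proof -
  define w where "w b = (\<Sum>i\<in>b. (cmod (a i))\<^sup>2)" for b
  have A: "\<Union>P = A" and finP: "finite P" and "P \<noteq> {}"
    using assms finite_elements[of A P] by (auto simp: partition_on_def)
  have w_Union: "w (\<Union>\<alpha>) = sum w \<alpha>" if "\<alpha> \<subseteq> P" for \<alpha>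
  proof -
    have "disjoint \<alpha>"
      using assms(2) that by (auto simp: partition_on_def intro: pairwise_subset)
    moreover have "\<forall>b\<in>\<alpha>. finite b"
      using that A assms(1) by (intro ballI finite_subset[OF _ assms(1)]) auto
    ultimately show ?thesis
      unfolding w_def by (subst sum.Union_disjoint) (auto simp: disjoint_def)
  qed
  have wP: "sum w P = 1" using w_Union[of P] A norm by (simp add: w_def)
  define cut where "cut \<alpha> = sum w \<alpha> * sum w (P - \<alpha>)" for \<alpha>
  have purity: "Re (reduced_purity (\<lambda>_. 2) A (single_excitation a A) (\<Union>\<alpha>)) = 1 - 2 * cut \<alpha>"
    if "\<alpha> \<subseteq> P" for \<alpha>
  proof -
    have sub: "\<Union>\<alpha> \<subseteq> A" using that A by auto
    have split: "w A = w (A - \<Union>\<alpha>) + w (\<Union>\<alpha>)" "sum w P = sum w (P - \<alpha>) + sum w \<alpha>"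
      unfolding w_def using sub that assms(1) finP by (auto intro: sum.subset_diff)
    then have compl: "w (A - \<Union>\<alpha>) = 1 - sum w \<alpha>" "sum w (P - \<alpha>) = 1 - sum w \<alpha>"
      using w_Union[OF that] wP norm by (simp_all add: w_def[of A])
    then show ?thesis
      unfolding reduced_purity_single_excitation[OF assms(1) sub] w_def[symmetric] cut_def
        compl w_Union[OF that] by (simp add: power2_eq_square algebra_simps)
  qed
  have "card (Pow P - {{}, P}) = 2 ^ card P - 2"
    using finP \<open>P \<noteq> {}\<close> by (subst card_Diff_subset) (auto simp: card_Pow numeral_2_eq_2)
  \<comment> \<open>The lower bound on \<open>2 ^ card P\<close> keeps the natural-number
    subtraction from truncating when it is moved to the reals.\<close>
  moreover have "card {{}, P} \<le> card (Pow P)"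
    using finP by (intro card_mono) auto
  then have "(2::nat) \<le> 2 ^ card P"
    using finP \<open>P \<noteq> {}\<close> by (simp add: card_Pow)
  ultimately have card: "real (card (Pow P - {{}, P})) = 2 ^ card P - 2"
    by (simp add: of_nat_diff)
  have "(\<Sum>\<alpha>\<in>Pow P - {{}, P}. Re (reduced_purity (\<lambda>_. 2) A (single_excitation a A) (\<Union>\<alpha>)))
      = (\<Sum>\<alpha>\<in>Pow P - {{}, P}. 1 - 2 * cut \<alpha>)"
    by (intro sum.cong refl purity) auto
  also have "\<dots> = (2 ^ card P - 2) - 2 * (\<Sum>\<alpha>\<in>Pow P - {{}, P}. cut \<alpha>)"
    using card by (simp add: sum_subtractf flip: sum_distrib_left)
  \<comment> \<open>The excluded sets \<open>{}\<close> and \<open>P\<close> have cut 0, as one of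
    their sides is empty.\<close>
  also have "(\<Sum>\<alpha>\<in>Pow P - {{}, P}. cut \<alpha>) = sum cut (Pow P)"
    using finP by (intro sum.mono_neutral_left) (auto simp: cut_def)
  finally have sum_purity:
    "(\<Sum>\<alpha>\<in>Pow P - {{}, P}. Re (reduced_purity (\<lambda>_. 2) A (single_excitation a A) (\<Union>\<alpha>)))
      = (2 ^ card P - 2) - 2 * sum cut (Pow P)" .
  \<comment> \<open>Nonnegativity of the radicand lets squaring undo the square root.\<close>
  have "0 \<le> sum cut (Pow P)"
    unfolding cut_def w_def by (intro sum_nonneg mult_nonneg_nonneg) auto
  then have "(concurrence (\<lambda>_. 2) A (single_excitation a A) P)\<^sup>2
      = (2 powr (1 - real (card P) / 2))\<^sup>2 * (2 * sum cut (Pow P))"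
    unfolding concurrence_def sum_purity by (simp add: power_mult_distrib)
  also have "(2 powr (1 - real (card P) / 2))\<^sup>2 = 4 / 2 ^ card P"
    by (simp add: power2_eq_square powr_diff powr_realpow flip: powr_add)
  also have "4 / 2 ^ card P * (2 * sum cut (Pow P)) = 2 * (1 - (\<Sum>b\<in>P. (w b)\<^sup>2))"
    using sum_Pow_cut_weight[OF finP, of w] wP by (simp add: cut_def field_simps)
  finally show ?thesis by (simp add: w_def)
qed

section \<open>Partitions with one block fewer than elements\<close>

abbreviation (input) pairs_of :: "'i set \<Rightarrow> 'i set set" where
  "pairs_of A \<equiv> {e. e \<subseteq> A \<and> card e = 2}"

definition merged_partition :: "'i set \<Rightarrow> 'i set \<Rightarrow> 'i set set" where
  "merged_partition A e = insert e ((\<lambda>i. {i}) ` (A - e))"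

text \<open>The pair can be recovered as the only block with two elements.\<close>

lemma inj_on_merged_partition: "inj_on (merged_partition A) (pairs_of A)"
proof (rule inj_onI)
  fix e f assume "e \<in> pairs_of A" "f \<in> pairs_of A" "merged_partition A e = merged_partition A f"
  then have "e \<in> insert f ((\<lambda>i. {i}) ` (A - f))" "card e = 2"
    by (auto simp: merged_partition_def)
  then show "e = f" by auto
qed

lemma merged_partition:
  assumes "finite A" "e \<in> pairs_of A"
  shows "partition_on A (merged_partition A e)" "card (merged_partition A e) = card A - 1"
proof -
  have e: "e \<subseteq> A" "card e = 2" "finite e" and "e \<noteq> {}"
    using assms by (auto intro: finite_subset)
  then show "partition_on A (merged_partition A e)"
    by (auto simp: partition_on_def merged_partition_def disjoint_def)
  \<comment> \<open>The block count is \<open>1 + (card A - 2)\<close>, which equals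
    \<open>card A - 1\<close> in the naturals only with this bound.\<close>
  have "card A \<ge> 2" using card_mono[OF assms(1) e(1)] e(2) by simp
  moreover have "e \<notin> (\<lambda>i. {i}) ` (A - e)" using e by auto
  ultimately show "card (merged_partition A e) = card A - 1"
    using e assms(1) by (simp add: merged_partition_def card_image card_Diff_subset)
qed

text \<open>The excesses \<open>card b - 1\<close> over the blocks sum to
  \<open>card A - card P = 1\<close>, so exactly one block has two elements and all others are
  singletons.\<close>

lemma partition_on_card_diff_1:
  assumes "finite A" "A \<noteq> {}" "partition_on A P" "card P = card A - 1"
  obtains e where "e \<in> pairs_of A" "P = merged_partition A e"
proof -
  have finP: "finite P" and A: "\<Union>P = A" and "{} \<notin> P" and disj: "disjoint P"
    using assms finite_elements[of A P] by (auto simp: partition_on_def)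
  then have fin: "finite b" if "b \<in> P" for b
    using that assms(1) by (auto intro: finite_subset)
  then have pos: "card b \<ge> 1" if "b \<in> P" for b
    using that \<open>{} \<notin> P\<close> by (metis One_nat_def Suc_leI card_gt_0_iff)
  have "card A = sum card P"
    unfolding A[symmetric] using disj fin by (rule card_Union_disjoint)
  \<comment> \<open>Blocks are nonempty, so subtracting 1 from their sizes loses nothing.\<close>
  also have "\<dots> = (\<Sum>b\<in>P. (card b - 1) + 1)"
    by (intro sum.cong refl) (rule le_add_diff_inverse2[OF pos, symmetric])
  also have "\<dots> = (\<Sum>b\<in>P. card b - 1) + card P"
    by (simp only: sum.distrib sum_constant) simp
  finally have "(\<Sum>b\<in>P. card b - 1) = 1"
    using assms(1,2,4) card_gt_0_iff[of A] by simp
  then obtain e where e: "e \<in> P" "card e - 1 = 1" "\<forall>b\<in>P. e \<noteq> b \<longrightarrow> card b - 1 = 0"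
    unfolding sum_eq_1_iff[OF finP] by blast
  have sing: "\<exists>i\<in>A - e. b = {i}" if "b \<in> P" "b \<noteq> e" for b
  proof -
    have "card b - 1 = 0" using e(3) that by blast
    then have "card b = 1" using pos[OF that(1)] by simp
    then obtain i where "b = {i}" by (rule card_1_singletonE)
    moreover have "b \<inter> e = {}" using disjointD[OF disj that(1) e(1) that(2)] .
    moreover have "b \<subseteq> A" using A that(1) by blast
    ultimately show ?thesis by simp
  qed
  have "P = merged_partition A e"
  proof (intro set_eqI iffI)
    fix b assume "b \<in> P"
    then show "b \<in> merged_partition A e"
      using sing[of b] by (auto simp: merged_partition_def)
  next
    fix b assume "b \<in> merged_partition A e"
    then consider "b = e" | i where "i \<in> A - e" "b = {i}"
      by (auto simp: merged_partition_def)
    then show "b \<in> P"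
    proof cases
      case 2
      \<comment> \<open>The block \<open>c\<close> contains \<open>i\<close>, which is not in
        \<open>e\<close>; hence \<open>c\<close> differs from \<open>e\<close>, and
        \<open>sing\<close> forces \<open>c = {i}\<close>.\<close>
      then obtain c where "c \<in> P" "i \<in> c" using A by blast
      then show ?thesis using 2 sing[of c] by blast
    qed (use e in simp)
  qed
  moreover have "e \<in> pairs_of A"
    using e(1,2) A by auto
  ultimately show ?thesis using that by blast
qed

lemma bij_betw_merged_partition:
  assumes "finite A" "A \<noteq> {}"
  shows "bij_betw (merged_partition A) (pairs_of A) {P. partition_on A P \<and> card P = card A - 1}"
  unfolding bij_betw_def
proof (intro conjI inj_on_merged_partition set_eqI iffI)
  fix P assume "P \<in> merged_partition A ` pairs_of A"
  then show "P \<in> {P. partition_on A P \<and> card P = card A - 1}"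
    using merged_partition[OF assms(1)] by auto
next
  fix P assume "P \<in> {P. partition_on A P \<and> card P = card A - 1}"
  then show "P \<in> merged_partition A ` pairs_of A"
    using partition_on_card_diff_1[OF assms, of P] by blast
qed

text \<open>On a pair {i, j} the summand is 2 p(i) p(j), so this is the expansion of the square of a
  sum. Each summand is half of what merging that pair takes off the squared concurrence.\<close>

lemma sum_pairs_of_cross_terms:
  fixes p :: "'i \<Rightarrow> real"
  assumes "finite A"
  shows "(\<Sum>e\<in>pairs_of A. (sum p e)\<^sup>2 - (\<Sum>i\<in>e. (p i)\<^sup>2)) = (sum p A)\<^sup>2 - (\<Sum>i\<in>A. (p i)\<^sup>2)"
  using assms
proof (induction A)
  case empty
  have "pairs_of {} = ({} :: 'i set set)" by auto
  then show ?case by (simp only:) simp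
next
  case (insert x A)
  let ?g = "\<lambda>e. (sum p e)\<^sup>2 - (\<Sum>i\<in>e. (p i)\<^sup>2)"
  have pairs: "pairs_of (insert x A) = pairs_of A \<union> (\<lambda>y. {x, y}) ` A"
  proof (intro set_eqI iffI)
    fix e assume e: "e \<in> pairs_of (insert x A)"
    then obtain u v where "e = {u, v}" "u \<noteq> v" by (auto simp: card_2_iff)
    with e show "e \<in> pairs_of A \<union> (\<lambda>y. {x, y}) ` A" by auto
  next
    fix e assume "e \<in> pairs_of A \<union> (\<lambda>y. {x, y}) ` A"
    then show "e \<in> pairs_of (insert x A)" using insert.hyps by (auto simp: card_2_iff)
  qed
  have "sum ?g (pairs_of (insert x A)) = sum ?g (pairs_of A) + sum ?g ((\<lambda>y. {x, y}) ` A)"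
    unfolding pairs using insert.hyps by (intro sum.union_disjoint) auto
  also have "sum ?g ((\<lambda>y. {x, y}) ` A) = (\<Sum>y\<in>A. ?g {x, y})"
    using insert.hyps by (subst sum.reindex) (auto simp: inj_on_def doubleton_eq_iff)
  also have "\<dots> = (\<Sum>y\<in>A. 2 * p x * p y)"
  proof (intro sum.cong refl)
    fix y assume "y \<in> A"
    then have "x \<noteq> y" using insert.hyps by auto
    then show "?g {x, y} = 2 * p x * p y" by (simp add: power2_eq_square algebra_simps)
  qed
  also have "\<dots> = 2 * p x * sum p A" by (simp add: sum_distrib_left)
  finally show ?case
    using insert by (simp add: power2_eq_square algebra_simps)
qed

section \<open>Comparison of the full concurrence with the total over merged pairs\<close>

theorem theorem3:
  fixes N :: nat and a :: "nat \<Rightarrow> complex"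
  assumes "N \<ge> 3"
    and "(\<Sum>i=1..N. (cmod (a i))\<^sup>2) = 1"
  shows "(full_concurrence (\<lambda>_. 2) {1..N} (W_state N a))\<^sup>2 =
         1 / (real (N choose 2) - 1) *
         total_sq_concurrence (\<lambda>_. 2) {1..N} (N - 1) (W_state N a)"
proof -
  let ?A = "{1..N}"
  let ?C = "\<lambda>P. (concurrence (\<lambda>_. 2) ?A (W_state N a) P)\<^sup>2"
  define p where "p i = (cmod (a i))\<^sup>2" for i
  have A: "finite ?A" "?A \<noteq> {}" using assms(1) by auto
  have norm: "sum p ?A = 1" using assms(2) by (simp add: p_def)
  have C: "?C P = 2 * (1 - (\<Sum>b\<in>P. (sum p b)\<^sup>2))" if "partition_on ?A P" for P
    using concurrence_single_excitation[OF A(1) that A(2) assms(2)]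
    by (simp add: W_state_eq_single_excitation p_def)
  define Q where "Q = (\<Sum>i\<in>?A. (p i)\<^sup>2)"
  have "partition_on ?A ((\<lambda>i. {i}) ` ?A)"
    by (auto simp: partition_on_def disjoint_def)
  from C[OF this] have full: "(full_concurrence (\<lambda>_. 2) ?A (W_state N a))\<^sup>2 = 2 * (1 - Q)"
    by (simp add: full_concurrence_def sum.reindex Q_def)
  \<comment> \<open>Merging replaces the squared weights of the two singletons in \<open>Q\<close>
    by the square of their sum.\<close>
  have merged: "?C (merged_partition ?A e) = 2 * (1 - Q) - 2 * ((sum p e)\<^sup>2 - (\<Sum>i\<in>e. (p i)\<^sup>2))"
    if e: "e \<in> pairs_of ?A" for e
  proof -
    have "e \<notin> (\<lambda>i. {i}) ` (?A - e)" using e by auto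
    then have "(\<Sum>b\<in>merged_partition ?A e. (sum p b)\<^sup>2) = (sum p e)\<^sup>2 + (\<Sum>i\<in>?A - e. (p i)\<^sup>2)"
      by (simp add: merged_partition_def sum.reindex)
    moreover have "Q = (\<Sum>i\<in>?A - e. (p i)\<^sup>2) + (\<Sum>i\<in>e. (p i)\<^sup>2)"
      unfolding Q_def using e by (intro sum.subset_diff) auto
    ultimately show ?thesis
      using C[OF merged_partition(1)[OF A(1) e]] by simp
  qed
  have "card (pairs_of ?A) = N choose 2"
    using n_subsets[OF A(1), of 2] by simp
  have "total_sq_concurrence (\<lambda>_. 2) ?A (N - 1) (W_state N a)
      = (\<Sum>e\<in>pairs_of ?A. ?C (merged_partition ?A e))"
    unfolding total_sq_concurrence_def
    using sum.reindex_bij_betw[OF bij_betw_merged_partition[OF A], of ?C] by simp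
  also have "\<dots> = (\<Sum>e\<in>pairs_of ?A. 2 * (1 - Q) - 2 * ((sum p e)\<^sup>2 - (\<Sum>i\<in>e. (p i)\<^sup>2)))"
    by (intro sum.cong refl merged)
  also have "\<dots> = real (N choose 2) * (2 * (1 - Q))
      - 2 * (\<Sum>e\<in>pairs_of ?A. (sum p e)\<^sup>2 - (\<Sum>i\<in>e. (p i)\<^sup>2))"
    unfolding sum_subtractf[of "\<lambda>_. 2 * (1 - Q)"] sum_distrib_left[symmetric] sum_constant
      \<open>card (pairs_of ?A) = N choose 2\<close> by simp
  \<comment> \<open>By normalisation the cross terms sum to \<open>1 - Q\<close>, so the losses
    remove exactly one of the \<open>N choose 2\<close> copies of
    \<open>2 * (1 - Q)\<close>.\<close>
  also have "\<dots> = (real (N choose 2) - 1) * (2 * (1 - Q))"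
    unfolding sum_pairs_of_cross_terms[OF A(1)] norm Q_def[symmetric] by (simp add: algebra_simps)
  finally have total: "total_sq_concurrence (\<lambda>_. 2) ?A (N - 1) (W_state N a)
      = (real (N choose 2) - 1) * (2 * (1 - Q))" .
  \<comment> \<open>From \<open>N \<ge> 3\<close> the binomial is at least 3, so the divisor is
    nonzero; for \<open>N = 2\<close> it would be 0.\<close>
  have "3 choose 2 \<le> N choose 2"
    using assms(1) by (rule binomial_right_mono)
  then have "real (N choose 2) - 1 \<noteq> 0"
    by (simp add: eval_nat_numeral)
  then show ?thesis
    unfolding full total by simp
qed

end
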